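(* Let $R$ be a commutative ring with unity, let $\{a_{n}\}_{n\geq 0}$ be a sequence of elements of $R$, let $S=\sum_{i\geq 0}a_{i}X^{i}\in R[[X]]$, let $k$ be a nonnegative integer, and write $S^{k}=\sum_{i\geq 0}\mathbf{a}_{i}^{(k)}X^{i}$. Then for all $n\ge 0$, $$\mathbf{a}_{n+1}^{(k)}=\sum_{i=0}^{n}a_{i+1}\,\widehat{\mathbf{a}}_{n-i}^{(k)},$$ where $\widehat{\mathbf{a}}_{0}^{(k)}=a_{0}^{k-1}\binom{k}{1}$ and, for $n\ge 1$, $$\widehat{\mathbf{a}}_{n}^{(k)}=\sum_{p=1}^{n}a_{0}^{k-p-1}\binom{k}{p+1}\sum_{\substack{k_1+k_2+\cdots+k_n=p \\ k_1+2k_2+\cdots+nk_n=n}}\frac{p!}{k_{1}!\cdots k_{n}!}\, a_{1}^{k_{1}}\cdots a_{n}^{k_{n}}.$$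
   Context: The inner sum is over tuples of nonnegative integers $(k_1,\ldots,k_n)$ satisfying the two displayed conditions. Convention: $a_0^{k-q}\binom{k}{q}$ is $0$ when $q>k$ and is $1$ when $q=k$ (even if $a_0$ is not invertible). Multinomial coefficients are regarded as elements of $R$. *)

theory Defs
  imports
    "HOL-Computational_Algebra.Formal_Power_Series"
    "HOL-Library.FuncSet"
begin

text \<open>
  The coefficient written $a_0^{k-q}\binom{k}{q}$: it is $0$ for $q > k$, where the exponent
  is negative, and $1$ for $q = k$, where the exponent is $0$.
\<close>

definition pow_binom :: "'a::comm_ring_1 \<Rightarrow> nat \<Rightarrow> nat \<Rightarrow> 'a" where
  "pow_binom a0 k q = (if q \<le> k then a0 ^ (k - q) * of_nat (k choose q) else 0)"

lemma pow_binom_self: "pow_binom a0 k k = 1"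
  by (simp add: pow_binom_def)

text \<open>
  A tuple $(k_1,\ldots,k_n)$ of nonnegative integers is an extensional function on
  \<open>{1..n}\<close>, so that each tuple is counted exactly once.
\<close>

definition tuples :: "nat \<Rightarrow> nat \<Rightarrow> (nat \<Rightarrow> nat) set" where
  "tuples n p = {\<kappa> \<in> {1..n} \<rightarrow>\<^sub>E UNIV. (\<Sum>i=1..n. \<kappa> i) = p \<and> (\<Sum>i=1..n. i * \<kappa> i) = n}"

lemma finite_tuples: "finite (tuples n p)"
proof (rule finite_subset)
  show "tuples n p \<subseteq> {1..n} \<rightarrow>\<^sub>E {..p}"
  proof
    fix \<kappa> assume "\<kappa> \<in> tuples n p"
    then have ext: "\<kappa> \<in> {1..n} \<rightarrow>\<^sub>E UNIV" and s: "(\<Sum>i=1..n. \<kappa> i) = p"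
      by (auto simp: tuples_def)
    have "\<kappa> i \<le> p" if "i \<in> {1..n}" for i
      using member_le_sum[of i "{1..n}" \<kappa>] that s by simp
    with ext show "\<kappa> \<in> {1..n} \<rightarrow>\<^sub>E {..p}"
      by (auto simp: PiE_def)
  qed
  show "finite ({1..n} \<rightarrow>\<^sub>E {..p})"
    by (intro finite_PiE) auto
qed

definition multinomial :: "nat \<Rightarrow> nat \<Rightarrow> (nat \<Rightarrow> nat) \<Rightarrow> nat" where
  "multinomial n p \<kappa> = fact p div (\<Prod>i=1..n. fact (\<kappa> i))"

text \<open>The division in \<open>multinomial\<close> is exact for the tuples it is applied to.\<close>

lemma prod_fact_dvd_fact_sum:
  "finite A \<Longrightarrow> (\<Prod>i\<in>A. fact (\<kappa> i)) dvd (fact (\<Sum>i\<in>A. \<kappa> i) :: nat)"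
proof (induction A rule: finite_induct)
  case (insert x A)
  have "(fact (\<kappa> x) * (\<Prod>i\<in>A. fact (\<kappa> i)) :: nat) dvd fact (\<kappa> x) * fact (\<Sum>i\<in>A. \<kappa> i)"
    using insert.IH by (rule mult_dvd_mono[OF dvd_refl])
  also have "\<dots> dvd fact (\<kappa> x + (\<Sum>i\<in>A. \<kappa> i))"
    by (rule fact_fact_dvd_fact)
  finally show ?case
    using insert.hyps by simp
qed simp

lemma multinomial_exact:
  assumes "\<kappa> \<in> tuples n p"
  shows "multinomial n p \<kappa> * (\<Prod>i=1..n. fact (\<kappa> i)) = fact p"
  using assms prod_fact_dvd_fact_sum[of "{1..n}" \<kappa>]
  by (auto simp: tuples_def multinomial_def)

definition a_hat :: "(nat \<Rightarrow> 'a::comm_ring_1) \<Rightarrow> nat \<Rightarrow> nat \<Rightarrow> 'a" where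
  "a_hat a k n =
     (if n = 0 then pow_binom (a 0) k 1
      else \<Sum>p=1..n. pow_binom (a 0) k (p + 1) *
             (\<Sum>\<kappa>\<in>tuples n p. of_nat (multinomial n p \<kappa>) * (\<Prod>i=1..n. a i ^ \<kappa> i)))"

end

theory Submission
  imports Defs
begin

text \<open>
  Split off the constant term: \<open>S = a\<^sub>0 + T\<close> with \<open>T = X U\<close> and \<open>U = \<Sum>i. a\<^sub>i\<^sub>+\<^sub>1 X\<^sup>i\<close>.
  The binomial theorem turns \<open>S\<^sup>k\<close> into a combination of the powers \<open>T\<^sup>q\<close> whose coefficients
  are exactly the values of \<^const>\<open>pow_binom\<close>. The term \<open>q = 0\<close> is a constant; from every other
  term pull out one factor \<open>T = X U\<close>, which gives
  \<open>S\<^sup>k = a\<^sub>0\<^sup>k + X U \<cdot> (\<Sum>p<k. pow_binom a\<^sub>0 k (p + 1) T\<^sup>p)\<close>.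
  The claim is the coefficient of \<open>X\<^sup>n\<^sup>+\<^sup>1\<close> in this identity, once \<^const>\<open>a_hat\<close> is recognised
  as the coefficient sequence of the last factor (\<open>a_hat_eq_nth\<close>).

  That recognition rests on \<open>nth_power_eq_sum_tuples\<close>: the coefficient of \<open>X\<^sup>n\<close> in \<open>T\<^sup>p\<close> only
  depends on the polynomial \<open>a\<^sub>1 X + \<dots> + a\<^sub>n X\<^sup>n\<close>, to whose power the multinomial theorem applies;
  the second condition on the tuples selects the monomials of degree \<open>n\<close>. Division by
  factorials happens only in the natural numbers, where it is exact, so the argument is valid over
  every commutative ring.
\<close>

section \<open>The multinomial theorem\<close>

definition exponent_vectors :: "'b set \<Rightarrow> nat \<Rightarrow> ('b \<Rightarrow> nat) set" where
  "exponent_vectors A p = {\<kappa> \<in> A \<rightarrow>\<^sub>E UNIV. (\<Sum>i\<in>A. \<kappa> i) = p}"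

lemma finite_exponent_vectors:
  assumes "finite A"
  shows "finite (exponent_vectors A p)"
proof (rule finite_subset)
  show "exponent_vectors A p \<subseteq> A \<rightarrow>\<^sub>E {..p}"
  proof
    fix \<kappa> assume "\<kappa> \<in> exponent_vectors A p"
    then have ext: "\<kappa> \<in> A \<rightarrow>\<^sub>E UNIV" and s: "(\<Sum>i\<in>A. \<kappa> i) = p"
      by (auto simp: exponent_vectors_def)
    have "\<kappa> i \<le> p" if "i \<in> A" for i
      using member_le_sum[of i A \<kappa>] that s assms by simp
    with ext show "\<kappa> \<in> A \<rightarrow>\<^sub>E {..p}"
      by (auto simp: PiE_def)
  qed
  show "finite (A \<rightarrow>\<^sub>E {..p})"
    using assms by (intro finite_PiE) auto
qed

lemma exponent_vectors_empty:
  "exponent_vectors {} p = (if p = 0 then {\<lambda>_. undefined} else {})"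
  by (auto simp: exponent_vectors_def)

text \<open>
  This is the recursion for multinomial coefficients that drives the induction below; the
  divisibility premise is what makes the natural number division on the right exact.
\<close>

lemma fact_div_mult_eq_choose:
  fixes P :: nat
  assumes "j \<le> p" and "P dvd fact (p - j)" and "P > 0"
  shows "fact p div (fact j * P) = (p choose j) * (fact (p - j) div P)"
proof -
  from assms obtain m where m: "fact (p - j) = P * m"
    by (auto elim: dvdE)
  have "fact p = (fact j * P) * ((p choose j) * m)"
    using binomial_fact_lemma[OF assms(1)] m by (simp add: algebra_simps)
  then show ?thesis
    using assms(3) m by simp
qed

text \<open>
  Induction on the index set: the binomial theorem separates the new summand, and an exponent
  vector on \<open>insert b A\<close> is an exponent \<open>j\<close> for \<open>b\<close> together with a vector on \<open>A\<close> of total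
  \<open>p - j\<close>.
\<close>

theorem multinomial_theorem:
  fixes x :: "'b \<Rightarrow> 'c::comm_semiring_1"
  assumes "finite A"
  shows "(\<Sum>i\<in>A. x i) ^ p =
    (\<Sum>\<kappa>\<in>exponent_vectors A p.
       of_nat (fact p div (\<Prod>i\<in>A. fact (\<kappa> i))) * (\<Prod>i\<in>A. x i ^ \<kappa> i))"
  using assms
proof (induction A arbitrary: p rule: finite_induct)
  case empty
  show ?case
    by (simp add: exponent_vectors_empty power_0_left)
next
  case (insert b A)
  define G :: "nat \<Rightarrow> ('b \<Rightarrow> nat) \<Rightarrow> 'c" where
    "G q \<kappa> = of_nat (fact q div (\<Prod>i\<in>A. fact (\<kappa> i))) * (\<Prod>i\<in>A. x i ^ \<kappa> i)" for q \<kappa>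
  have "(\<Sum>i\<in>insert b A. x i) ^ p = (x b + (\<Sum>i\<in>A. x i)) ^ p"
    using insert.hyps by simp
  also have "\<dots> = (\<Sum>j\<le>p. of_nat (p choose j) * x b ^ j * (\<Sum>i\<in>A. x i) ^ (p - j))"
    by (rule binomial_ring)
  also have "\<dots> = (\<Sum>j\<le>p. \<Sum>\<kappa>\<in>exponent_vectors A (p - j).
      of_nat (p choose j) * x b ^ j * G (p - j) \<kappa>)"
    by (simp add: insert.IH sum_distrib_left G_def)
  also have "\<dots> = (\<Sum>(j, \<kappa>)\<in>(SIGMA j:{..p}. exponent_vectors A (p - j)).
      of_nat (p choose j) * x b ^ j * G (p - j) \<kappa>)"
    by (rule sum.Sigma) (auto intro: finite_exponent_vectors insert.hyps)
  also have "\<dots> = (\<Sum>\<kappa>\<in>exponent_vectors (insert b A) p.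
      of_nat (fact p div (\<Prod>i\<in>insert b A. fact (\<kappa> i))) * (\<Prod>i\<in>insert b A. x i ^ \<kappa> i))"
  proof (rule sum.reindex_bij_witness[where i = "\<lambda>\<kappa>. (\<kappa> b, \<kappa>(b := undefined))"
        and j = "\<lambda>(j, \<kappa>). \<kappa>(b := j)"], goal_cases)
    case (1 z)
    then show ?case
      using insert.hyps by (auto simp: exponent_vectors_def PiE_def extensional_def)
  next
    case (2 z)
    then obtain j \<kappa> where z: "z = (j, \<kappa>)" "j \<le> p" "\<kappa> \<in> exponent_vectors A (p - j)"
      by auto
    have "(\<Sum>i\<in>A. (\<kappa>(b := j)) i) = (\<Sum>i\<in>A. \<kappa> i)"
      using insert.hyps by (intro sum.cong) auto
    with z show ?case
      using insert.hyps by (auto simp: exponent_vectors_def PiE_def extensional_def)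
  next
    case (3 \<kappa>)
    then show ?case by simp
  next
    case (4 \<kappa>)
    have "(\<Sum>i\<in>A. (\<kappa>(b := undefined)) i) = (\<Sum>i\<in>A. \<kappa> i)"
      using insert.hyps by (intro sum.cong) auto
    with 4 show ?case
      using insert.hyps by (auto simp: exponent_vectors_def PiE_def extensional_def)
  next
    case (5 z)
    then obtain j \<kappa> where z: "z = (j, \<kappa>)" "j \<le> p" "\<kappa> \<in> exponent_vectors A (p - j)"
      by auto
    have P: "(\<Prod>i\<in>A. fact ((\<kappa>(b := j)) i) :: nat) = (\<Prod>i\<in>A. fact (\<kappa> i))"
      and Q: "(\<Prod>i\<in>A. x i ^ ((\<kappa>(b := j)) i)) = (\<Prod>i\<in>A. x i ^ \<kappa> i)"
      using insert.hyps by (auto intro!: prod.cong)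
    have "(\<Prod>i\<in>A. fact (\<kappa> i)) dvd (fact (p - j) :: nat)"
      using prod_fact_dvd_fact_sum[OF insert.hyps(1), of \<kappa>] z
      by (simp add: exponent_vectors_def)
    then have "fact p div (fact j * (\<Prod>i\<in>A. fact (\<kappa> i))) =
        (p choose j) * (fact (p - j) div (\<Prod>i\<in>A. fact (\<kappa> i)))"
      by (intro fact_div_mult_eq_choose z) (auto intro: prod_pos)
    then show ?case
      using insert.hyps by (simp add: z G_def P Q mult_ac del: fun_upd_apply)
        (simp add: mult_ac)
  qed
  finally show ?case .
qed

section \<open>Coefficients of powers of a series without constant term\<close>

lemma fps_nth_power_cong:
  fixes f g :: "'a::comm_ring_1 fps"
  assumes "\<And>i. i \<le> n \<Longrightarrow> fps_nth f i = fps_nth g i" and "m \<le> n"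
  shows "fps_nth (f ^ p) m = fps_nth (g ^ p) m"
  using assms(2)
proof (induction p arbitrary: m)
  case (Suc p)
  then show ?case
    by (auto simp: fps_mult_nth assms(1) intro!: sum.cong)
qed simp

lemma prod_monomials_fps:
  fixes a :: "nat \<Rightarrow> 'a::comm_ring_1"
  shows "(\<Prod>i\<in>A. (fps_const (a i) * fps_X ^ i) ^ \<kappa> i) =
    fps_const (\<Prod>i\<in>A. a i ^ \<kappa> i) * fps_X ^ (\<Sum>i\<in>A. i * \<kappa> i)"
  by (induction A rule: infinite_finite_induct)
    (auto simp: power_mult_distrib power_add fps_const_power mult_ac
        simp flip: fps_const_mult power_mult)

text \<open>
  The multinomial theorem needs a finite sum, hence the truncation to degree at most \<open>n\<close>. In the
  expansion each \<open>\<kappa>\<close> yields a single monomial of degree \<open>\<Sum>i. i \<cdot> \<kappa> i\<close>, so the coefficient of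
  \<open>X\<^sup>n\<close> keeps exactly the \<open>\<kappa>\<close> of weight \<open>n\<close>.
\<close>

lemma nth_power_eq_sum_tuples:
  fixes a :: "nat \<Rightarrow> 'a::comm_ring_1"
  shows "fps_nth ((fps_X * Abs_fps (\<lambda>i. a (i + 1))) ^ p) n =
    (\<Sum>\<kappa>\<in>tuples n p. of_nat (multinomial n p \<kappa>) * (\<Prod>i=1..n. a i ^ \<kappa> i))"
proof -
  let ?mono = "\<lambda>i. fps_const (a i) * fps_X ^ i"
  have trunc: "fps_nth (fps_X * Abs_fps (\<lambda>i. a (i + 1))) m = fps_nth (\<Sum>i=1..n. ?mono i) m"
    if "m \<le> n" for m
  proof -
    have "fps_nth (\<Sum>i=1..n. ?mono i) m = (\<Sum>i=1..n. if i = m then a i else 0)"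
      unfolding fps_sum_nth by (rule sum.cong) auto
    with that show ?thesis
      by auto
  qed
  have "fps_nth ((fps_X * Abs_fps (\<lambda>i. a (i + 1))) ^ p) n = fps_nth ((\<Sum>i=1..n. ?mono i) ^ p) n"
    by (rule fps_nth_power_cong[OF trunc]) auto
  also have "\<dots> = (\<Sum>\<kappa>\<in>exponent_vectors {1..n} p.
      if (\<Sum>i=1..n. i * \<kappa> i) = n
      then of_nat (multinomial n p \<kappa>) * (\<Prod>i=1..n. a i ^ \<kappa> i) else 0)"
    by (subst multinomial_theorem)
      (auto simp: fps_sum_nth prod_monomials_fps multinomial_def fps_of_nat[symmetric]
        simp del: fps_of_nat intro!: sum.cong)
  also have "\<dots> = (\<Sum>\<kappa>\<in>tuples n p. of_nat (multinomial n p \<kappa>) * (\<Prod>i=1..n. a i ^ \<kappa> i))"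
    by (rule sum.mono_neutral_cong_right)
      (auto simp: exponent_vectors_def tuples_def finite_exponent_vectors[unfolded exponent_vectors_def])
  finally show ?thesis .
qed

text \<open>
  The range of \<open>p\<close> is \<open>1 \<le> p \<le> n\<close> on one side and \<open>p < k\<close> on the other. Let \<open>T\<close> be the series whose
  powers occur here. The terms with \<open>p \<ge> k\<close>
  vanish by the convention for \<open>pow_binom\<close>, those with \<open>p > n\<close> because \<open>X\<^sup>p\<close> divides \<open>T\<^sup>p\<close>, and
  \<open>T\<^sup>0 = 1\<close> contributes only for \<open>n = 0\<close>, the case that the definition treats separately.
\<close>

lemma a_hat_eq_nth:
  fixes a :: "nat \<Rightarrow> 'a::comm_ring_1"
  shows "a_hat a k n = (\<Sum>p<k. pow_binom (a 0) k (p + 1) *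
    fps_nth ((fps_X * Abs_fps (\<lambda>i. a (i + 1))) ^ p) n)"
proof -
  let ?c = "\<lambda>p. fps_nth ((fps_X * Abs_fps (\<lambda>i. a (i + 1))) ^ p) n"
  let ?t = "\<lambda>p. pow_binom (a 0) k (p + 1) * ?c p"
  have high: "?c p = 0" if "p > n" for p
    using that by (simp add: power_mult_distrib fps_X_power_mult_nth)
  have "(\<Sum>p<k. ?t p) = (\<Sum>p\<le>n + k. ?t p)"
    by (rule sum.mono_neutral_left) (auto simp: pow_binom_def)
  also have "\<dots> = (\<Sum>p\<le>n. ?t p)"
    by (rule sum.mono_neutral_right) (auto simp: not_le high[simplified])
  also have "\<dots> = a_hat a k n"
  proof (cases "n = 0")
    case False
    then have "(\<Sum>p\<le>n. ?t p) = (\<Sum>p=1..n. ?t p)"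
      by (intro sum.mono_neutral_right) (auto simp: not_le)
    with False show ?thesis
      unfolding a_hat_def nth_power_eq_sum_tuples by simp
  qed (simp add: a_hat_def)
  finally show ?thesis ..
qed

section \<open>The coefficients of \<open>S\<^sup>k\<close>\<close>

text \<open>
  The binomial theorem; the value \<open>1\<close> of \<^const>\<open>pow_binom\<close> at \<open>q = k\<close> is its empty power \<open>c\<^sup>0\<close>.
\<close>

lemma power_const_plus_eq:
  fixes c :: "'a::comm_ring_1"
  shows "(fps_const c + f) ^ k = (\<Sum>q\<le>k. fps_const (pow_binom c k q) * f ^ q)"
proof -
  have "(f + fps_const c) ^ k = (\<Sum>q\<le>k. of_nat (k choose q) * f ^ q * fps_const c ^ (k - q))"
    by (rule binomial_ring)
  also have "\<dots> = (\<Sum>q\<le>k. fps_const (pow_binom c k q) * f ^ q)"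
    by (intro sum.cong refl)
      (simp add: pow_binom_def fps_const_power fps_of_nat mult_ac flip: fps_const_mult)
  finally show ?thesis
    by (simp add: add.commute)
qed

theorem theorem1p7:
  fixes a :: "nat \<Rightarrow> 'a::comm_ring_1" and k n :: nat
  shows "fps_nth (Abs_fps a ^ k) (n + 1) = (\<Sum>i=0..n. a (i + 1) * a_hat a k (n - i))"
proof -
  define U where "U = Abs_fps (\<lambda>i. a (i + 1))"
  define T where "T = fps_X * U"
  define H where "H = (\<Sum>p<k. fps_const (pow_binom (a 0) k (p + 1)) * T ^ p)"
  have "Abs_fps a = fps_const (a 0) + T"
    by (auto simp: fps_eq_iff T_def U_def)
  then have "Abs_fps a ^ k = (\<Sum>q\<le>k. fps_const (pow_binom (a 0) k q) * T ^ q)"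
    by (simp add: power_const_plus_eq)
  also have "\<dots> = fps_const (pow_binom (a 0) k 0) +
      (\<Sum>p<k. fps_const (pow_binom (a 0) k (p + 1)) * T ^ (p + 1))"
    by (simp add: sum.atMost_shift)
  also have "(\<Sum>p<k. fps_const (pow_binom (a 0) k (p + 1)) * T ^ (p + 1)) = fps_X * (U * H)"
    by (simp add: H_def T_def sum_distrib_left mult_ac)
  finally have "fps_nth (Abs_fps a ^ k) (n + 1) = fps_nth (U * H) n"
    by simp
  also have "\<dots> = (\<Sum>i=0..n. a (i + 1) * fps_nth H (n - i))"
    by (simp add: fps_mult_nth U_def)
  also have "\<dots> = (\<Sum>i=0..n. a (i + 1) * a_hat a k (n - i))"
    by (simp add: H_def T_def U_def fps_sum_nth a_hat_eq_nth)
  finally show ?thesis .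
qed

end
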